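(* Let $V$, $M$, $M_1$, $M_2$, $\mathcal Z$, $\hat\mu$, $S$, $\mathcal N$, $\mathcal H_2'$, $\Pi^{\mathrm{split}}_{kl}$ and $\widehat C^{\mathrm{split}}_{kl}$ be as defined in the context, with $S$ a symmetric array. Suppose that: (1') (jointly exchangeable splitting mechanism) $(V^\sigma,M_1^\sigma,M_2^\sigma)\stackrel d=(V,M_1,M_2)$ for every $\sigma\in\Sigma_{\mathcal N}$, and additionally $M\ge M_1+M_2$ entrywise; (2) (network covariates) $\mathcal Z^\sigma=\zeta(\mathcal X^\sigma)$ for every permutation $\sigma$ of $[n]$; (3') (permutation-invariant model for split conformal prediction) $\boldsymbol{\hat\mu}^{\mathrm{split},\sigma}=\bigl(\hat\mu(\mathcal I^{\mathrm{split},\sigma}_{ij};\mathcal T^{\mathrm{split},\sigma})\bigr)_{1\le i,j\le n}$ for every permutation $\sigma$ of $[n]$. Then for any $1\le k<l\le n$ and any $t\in[0,1]$, $$P\left(\Pi^{\mathrm{split}}_{kl}\le t\mid M_2(k,l)=1\right)\le t.$$ Consequently, for any $\alpha\in[0,1]$, $$P\left(Y_{kl}\in\widehat C^{\mathrm{split}}_{kl}\mid M_2(k,l)=1\right)\ge 1-\alpha.$$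
   Context: Let $[n]=\{1,\dots,n\}$. For an array $B=(B_{ij})_{i,j\in[n]}$ and a permutation $\sigma$ of $[n]$, $B^\sigma=(B_{\sigma(i),\sigma(j)})_{i,j\in[n]}$. Data: $V=(V_{ij})_{i,j\in[n]}$ with $V_{ij}=(Y_{ij},X_i,X_j,E_{ij})$, where $Y_{ij}$ is a real response, $X_i$ a node covariate, and $E_{ij}$ an edge covariate. $M$ is a random binary $n\times n$ matrix indicating which pairs are sampled. $M_1$ and $M_2$ are binary $n\times n$ matrices with $M_1(i,j)=1$ (resp. $M_2(i,j)=1$) when the pair is in the training set (resp. the calibration set, which includes the test point). $\mathcal N\subseteq[n]$ is the set of nodes that have nonzero probability of belonging to an edge in the graph corresponding to $M_2$, and $\Sigma_{\mathcal N}$ is the group of permutations $\sigma$ of $[n]$ with $\sigma(i)=i$ for all $i\notin\mathcal N$. Network summary statistics: $\mathcal X=(\mathcal X_{ij})_{i,j\in[n]}$ with $\mathcal X_{ij}=(X_i,X_j,E_{ij},M_{ij})$, and $\mathcal Z=\zeta(\mathcal X)$ for a measurable function $\zeta$, where $\mathcal Z$ is an array with entries $(\mathcal Z_i,\mathcal Z_j,\mathcal Z_{ij})$ (node-level and pair-level summaries); below the subscript $ij$ on $\mathcal Z$ refers to the $(i,j)$ entry of this array. Model: with $\mathcal H_1=\{(i,j)\in[n]^2: M_1(i,j)=1\}$, $$\mathcal T^{\mathrm{split}}=(V_{ij},\mathcal Z_{ij})_{(i,j)\in\mathcal H_1},\qquad \mathcal I^{\mathrm{split}}=(\mathcal X_{ij},\mathcal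 Z_{ij},M_2(i,j))_{(i,j)\in[n]^2},$$ and, for a permutation $\sigma$, $\mathcal T^{\mathrm{split},\sigma}=(V^\sigma_{ij},\mathcal Z^\sigma_{ij})_{(i,j):\, M_1^\sigma(i,j)=1}$ and $\mathcal I^{\mathrm{split},\sigma}=(\mathcal X^\sigma_{ij},\mathcal Z^\sigma_{ij},M^\sigma_2(i,j))_{(i,j)\in[n]^2}$. The matrix of fitted values $\boldsymbol{\hat\mu}^{\mathrm{split}}\in\mathbb R^{n\times n}$ has entries $\boldsymbol{\hat\mu}^{\mathrm{split}}_{ij}=\hat\mu(\mathcal I^{\mathrm{split}}_{ij};\mathcal T^{\mathrm{split}})$, and $\boldsymbol{\hat\mu}^{\mathrm{split},\sigma}$ is this matrix with rows and columns permuted by $\sigma$. Scores: for a nonconformity score $s:\mathbb R\times\mathbb R\to\mathbb R$, $S_{ij}=s(Y_{ij},\boldsymbol{\hat\mu}^{\mathrm{split}}_{ij})$ and $S=(S_{ij})_{1\le i,j\le n}$. Let $\mathcal H_2'=\{(i,j):1\le i<j\le n,\ M_2(i,j)=1\}$ and $$\Pi^{\mathrm{split}}_{kl}=\frac1{|\mathcal H_2'|}\sum_{(i,j)\in\mathcal H_2'}\mathbf 1(S_{ij}\ge S_{kl}).$$ Split conformal prediction set: $\widehat C^{\mathrm{split}}_{kl}=\{y_{kl}:\Pi^{\mathrm{split}}_{kl}>\alpha\}$, where $\Pi^{\mathrm{split}}_{kl}$ is regarded as a function of the candidate value $y_{kl}$ substituted for $Y_{kl}$.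
   Formalization: The formal theorem assumes that the joint law of (V, M, M_1, M_2), not only of (V, M_1, M_2), is invariant under Σ_N, and that M_2 is almost surely symmetric; the claim fails without either assumption. *)

theory Defs
  imports "HOL-Probability.Probability"
begin

text \<open>
  The index set \<open>[n]\<close> is a finite linearly ordered type \<open>'n\<close>, with \<open>n = CARD('n)\<close>. Binary
  matrices are \<open>bool\<close>-valued arrays, the entry \<open>1\<close> being \<open>True\<close>.
\<close>

type_synonym ('n, 'a) array = "'n \<Rightarrow> 'n \<Rightarrow> 'a"

definition permute_array :: "('n \<Rightarrow> 'n) \<Rightarrow> ('n, 'a) array \<Rightarrow> ('n, 'a) array" where
  "permute_array \<sigma> B = (\<lambda>i j. B (\<sigma> i) (\<sigma> j))"

definition array_space :: "'a measure \<Rightarrow> ('n::finite, 'a) array measure" where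
  "array_space A = (\<Pi>\<^sub>M i\<in>UNIV. \<Pi>\<^sub>M j\<in>UNIV. A)"

abbreviation bool_space :: "bool measure" where
  "bool_space \<equiv> count_space UNIV"

section \<open>Data\<close>

type_synonym ('x, 'e) obs = "real \<times> 'x \<times> 'x \<times> 'e"

type_synonym ('x, 'e) covs = "'x \<times> 'x \<times> 'e \<times> bool"

text \<open>An entry \<open>(Z\<^sub>i, Z\<^sub>j, Z\<^sub>i\<^sub>j)\<close> of the array of summaries.\<close>
type_synonym ('z, 'p) summ = "'z \<times> 'z \<times> 'p"

definition obs_array ::
  "('n, real) array \<Rightarrow> ('n \<Rightarrow> 'x) \<Rightarrow> ('n, 'e) array \<Rightarrow> ('n, ('x, 'e) obs) array" where
  "obs_array Y X E = (\<lambda>i j. (Y i j, X i, X j, E i j))"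

definition covs_array ::
  "('n \<Rightarrow> 'x) \<Rightarrow> ('n, 'e) array \<Rightarrow> ('n, bool) array \<Rightarrow> ('n, ('x, 'e) covs) array" where
  "covs_array X E M = (\<lambda>i j. (X i, X j, E i j, M i j))"

definition obs_space :: "'x measure \<Rightarrow> 'e measure \<Rightarrow> ('x, 'e) obs measure" where
  "obs_space MX ME = borel \<Otimes>\<^sub>M MX \<Otimes>\<^sub>M MX \<Otimes>\<^sub>M ME"

definition covs_space :: "'x measure \<Rightarrow> 'e measure \<Rightarrow> ('x, 'e) covs measure" where
  "covs_space MX ME = MX \<Otimes>\<^sub>M MX \<Otimes>\<^sub>M ME \<Otimes>\<^sub>M bool_space"

definition summ_space :: "'z measure \<Rightarrow> 'p measure \<Rightarrow> ('z, 'p) summ measure" where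
  "summ_space MZ MP = MZ \<Otimes>\<^sub>M MZ \<Otimes>\<^sub>M MP"

definition summary_statistic ::
  "'x measure \<Rightarrow> 'e measure \<Rightarrow> 'z measure \<Rightarrow> 'p measure \<Rightarrow>
   (('n::finite, ('x, 'e) covs) array \<Rightarrow> ('n, ('z, 'p) summ) array) \<Rightarrow> bool" where
  "summary_statistic MX ME MZ MP \<zeta> \<longleftrightarrow>
     \<zeta> \<in> array_space (covs_space MX ME) \<rightarrow>\<^sub>M array_space (summ_space MZ MP) \<and>
     (\<exists>node pair. \<forall>x i j. \<zeta> x i j = (node x i, node x j, pair x i j))"

section \<open>Fitted values\<close>

text \<open>A family indexed by a subset of \<open>[n] \<times> [n]\<close> is a partial map with that domain.\<close>
type_synonym ('n, 'x, 'e, 'z, 'p) train = "'n \<times> 'n \<Rightarrow> (('x, 'e) obs \<times> ('z, 'p) summ) option"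

type_synonym ('x, 'e, 'z, 'p) info = "('x, 'e) covs \<times> ('z, 'p) summ \<times> bool"

type_synonym ('n, 'x, 'e, 'z, 'p) model =
  "('x, 'e, 'z, 'p) info \<Rightarrow> ('n, 'x, 'e, 'z, 'p) train \<Rightarrow> real"

definition train_split ::
  "('n, ('x, 'e) obs) array \<Rightarrow> ('n, ('z, 'p) summ) array \<Rightarrow> ('n, bool) array \<Rightarrow>
   ('n, 'x, 'e, 'z, 'p) train" where
  "train_split V Z M1 = (\<lambda>(i, j). if M1 i j then Some (V i j, Z i j) else None)"

definition info_split ::
  "('n, ('x, 'e) covs) array \<Rightarrow> ('n, ('z, 'p) summ) array \<Rightarrow> ('n, bool) array \<Rightarrow>
   ('n, ('x, 'e, 'z, 'p) info) array" where
  "info_split XX Z M2 = (\<lambda>i j. (XX i j, Z i j, M2 i j))"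

definition fitted_split ::
  "('n, 'x, 'e, 'z, 'p) model \<Rightarrow> ('n, ('x, 'e) obs) array \<Rightarrow> ('n, ('x, 'e) covs) array \<Rightarrow>
   ('n, ('z, 'p) summ) array \<Rightarrow> ('n, bool) array \<Rightarrow> ('n, bool) array \<Rightarrow> ('n, real) array" where
  "fitted_split mu V XX Z M1 M2 =
     (\<lambda>i j. mu (info_split XX Z M2 i j) (train_split V Z M1))"

text \<open>
  The space of partial maps carries no sigma-algebra here: \<open>mu\<close> is required to be jointly measurable
  in its first argument and the full arrays from which the training sample is cut out.
\<close>
definition measurable_model ::
  "'x measure \<Rightarrow> 'e measure \<Rightarrow> 'z measure \<Rightarrow> 'p measure \<Rightarrow>
   ('n::finite, 'x, 'e, 'z, 'p) model \<Rightarrow> bool" where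
  "measurable_model MX ME MZ MP mu \<longleftrightarrow>
     (\<lambda>(x, V, Z, M1). mu x (train_split V Z M1)) \<in> borel_measurable
       ((covs_space MX ME \<Otimes>\<^sub>M summ_space MZ MP \<Otimes>\<^sub>M bool_space) \<Otimes>\<^sub>M
        array_space (obs_space MX ME) \<Otimes>\<^sub>M array_space (summ_space MZ MP) \<Otimes>\<^sub>M
        array_space bool_space)"

section \<open>Scores and the prediction set\<close>

definition scores ::
  "(real \<Rightarrow> real \<Rightarrow> real) \<Rightarrow> ('n, 'x, 'e, 'z, 'p) model \<Rightarrow>
   (('n, ('x, 'e) covs) array \<Rightarrow> ('n, ('z, 'p) summ) array) \<Rightarrow>
   ('n, real) array \<Rightarrow> ('n \<Rightarrow> 'x) \<Rightarrow> ('n, 'e) array \<Rightarrow>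
   ('n, bool) array \<Rightarrow> ('n, bool) array \<Rightarrow> ('n, bool) array \<Rightarrow> ('n, real) array" where
  "scores s mu \<zeta> Y X E M M1 M2 =
     (let XX = covs_array X E M
      in (\<lambda>i j. s (Y i j) (fitted_split mu (obs_array Y X E) XX (\<zeta> XX) M1 M2 i j)))"

definition calib_pairs :: "('n::{finite,linorder}, bool) array \<Rightarrow> ('n \<times> 'n) set" where
  "calib_pairs M2 = {(i, j). i < j \<and> M2 i j}"

definition Pi_split ::
  "('n::{finite,linorder}, real) array \<Rightarrow> ('n, bool) array \<Rightarrow> 'n \<Rightarrow> 'n \<Rightarrow> real" where
  "Pi_split S M2 k l =
     1 / real (card (calib_pairs M2)) *
       (\<Sum>(i, j)\<in>calib_pairs M2. of_bool (S i j \<ge> S k l))"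

text \<open>
  The candidate \<open>y\<close> replaces the entry \<open>Y k l\<close> of the data, and everything that depends on it is
  recomputed. (If \<open>M1\<close> and \<open>M2\<close> are disjoint and \<open>M2 k l\<close> holds, the fit is unaffected.)
\<close>
definition C_split ::
  "(real \<Rightarrow> real \<Rightarrow> real) \<Rightarrow> ('n::{finite,linorder}, 'x, 'e, 'z, 'p) model \<Rightarrow>
   (('n, ('x, 'e) covs) array \<Rightarrow> ('n, ('z, 'p) summ) array) \<Rightarrow>
   ('n, real) array \<Rightarrow> ('n \<Rightarrow> 'x) \<Rightarrow> ('n, 'e) array \<Rightarrow>
   ('n, bool) array \<Rightarrow> ('n, bool) array \<Rightarrow> ('n, bool) array \<Rightarrow>
   real \<Rightarrow> 'n \<Rightarrow> 'n \<Rightarrow> real set" where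
  "C_split s mu \<zeta> Y X E M M1 M2 \<alpha> k l =
     {y. Pi_split (scores s mu \<zeta> (Y(k := (Y k)(l := y))) X E M M1 M2) M2 k l > \<alpha>}"

section \<open>Assumptions\<close>

text \<open>As in \<open>calib_pairs\<close>, diagonal entries of \<open>M2\<close> are not edges.\<close>
definition active_nodes :: "'w measure \<Rightarrow> ('w \<Rightarrow> ('n, bool) array) \<Rightarrow> 'n set" where
  "active_nodes P M2 = {i. \<P>(\<omega> in P. \<exists>j. j \<noteq> i \<and> M2 \<omega> i j) > 0}"

definition active_perms :: "'w measure \<Rightarrow> ('w \<Rightarrow> ('n, bool) array) \<Rightarrow> ('n \<Rightarrow> 'n) set" where
  "active_perms P M2 = {\<sigma>. \<sigma> permutes UNIV \<and> (\<forall>i. i \<notin> active_nodes P M2 \<longrightarrow> \<sigma> i = i)}"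

text \<open>
  The sampling matrix \<open>M\<close> takes part in the exchangeability: scores may depend on \<open>M\<close> through
  \<open>\<zeta>\<close> and \<open>mu\<close>, and conformal validity fails if only \<open>(V, M1, M2)\<close> is exchangeable while \<open>M\<close>
  singles out some nodes.
\<close>
definition exchangeable_splitting ::
  "'w measure \<Rightarrow> 'x measure \<Rightarrow> 'e measure \<Rightarrow> ('w \<Rightarrow> ('n::finite, ('x, 'e) obs) array) \<Rightarrow>
   ('w \<Rightarrow> ('n, bool) array) \<Rightarrow> ('w \<Rightarrow> ('n, bool) array) \<Rightarrow> ('w \<Rightarrow> ('n, bool) array) \<Rightarrow> bool" where
  "exchangeable_splitting P MX ME V M M1 M2 \<longleftrightarrow>
     (\<forall>\<sigma>\<in>active_perms P M2.
        let D = array_space (obs_space MX ME) \<Otimes>\<^sub>M array_space bool_space \<Otimes>\<^sub>M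
                array_space bool_space \<Otimes>\<^sub>M array_space bool_space
        in distr P D (\<lambda>\<omega>. (permute_array \<sigma> (V \<omega>), permute_array \<sigma> (M \<omega>),
                           permute_array \<sigma> (M1 \<omega>), permute_array \<sigma> (M2 \<omega>)))
           = distr P D (\<lambda>\<omega>. (V \<omega>, M \<omega>, M1 \<omega>, M2 \<omega>))) \<and>
     (AE \<omega> in P. \<forall>i j. (of_bool (M \<omega> i j) :: nat) \<ge> of_bool (M1 \<omega> i j) + of_bool (M2 \<omega> i j))"

definition equivariant_summaries ::
  "'w measure \<Rightarrow> (('n, ('x, 'e) covs) array \<Rightarrow> ('n, ('z, 'p) summ) array) \<Rightarrow>
   ('w \<Rightarrow> ('n, ('x, 'e) covs) array) \<Rightarrow> bool" where
  "equivariant_summaries P \<zeta> XX \<longleftrightarrow>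
     (\<forall>\<sigma>. \<sigma> permutes UNIV \<longrightarrow>
        (AE \<omega> in P. permute_array \<sigma> (\<zeta> (XX \<omega>)) = \<zeta> (permute_array \<sigma> (XX \<omega>))))"

definition permutation_invariant_model ::
  "'w measure \<Rightarrow> ('n, 'x, 'e, 'z, 'p) model \<Rightarrow> ('w \<Rightarrow> ('n, ('x, 'e) obs) array) \<Rightarrow>
   ('w \<Rightarrow> ('n, ('x, 'e) covs) array) \<Rightarrow> ('w \<Rightarrow> ('n, ('z, 'p) summ) array) \<Rightarrow>
   ('w \<Rightarrow> ('n, bool) array) \<Rightarrow> ('w \<Rightarrow> ('n, bool) array) \<Rightarrow> bool" where
  "permutation_invariant_model P mu V XX Z M1 M2 \<longleftrightarrow>
     (\<forall>\<sigma>. \<sigma> permutes UNIV \<longrightarrow>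
        (AE \<omega> in P.
           permute_array \<sigma> (fitted_split mu (V \<omega>) (XX \<omega>) (Z \<omega>) (M1 \<omega>) (M2 \<omega>)) =
           fitted_split mu (permute_array \<sigma> (V \<omega>)) (permute_array \<sigma> (XX \<omega>))
             (permute_array \<sigma> (Z \<omega>)) (permute_array \<sigma> (M1 \<omega>)) (permute_array \<sigma> (M2 \<omega>))))"

end

theory Submission
  imports Defs
begin

text \<open>
  The array of scores is an equivariant function of the data \<open>(V, M, M1, M2)\<close>, so the pair of scores
  and \<open>M2\<close> inherits joint exchangeability over the active nodes. Hence all pairs \<open>i < j\<close> of active
  nodes share the same \<open>P (\<Pi>\<^sub>i\<^sub>j \<le> t, M2 i j)\<close> and the same \<open>P (M2 i j)\<close>; a permutation may reverse
  the order of a pair, which is where symmetry of the scores and of \<open>M2\<close> enters. Almost surely every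
  calibration pair is active, and at most a fraction \<open>t\<close> of the calibration pairs have
  \<open>\<Pi>\<^sub>i\<^sub>j \<le> t\<close>. Taking expectations of this deterministic bound, summed over all active pairs, gives
  the claim even though the number of calibration pairs is random.
\<close>

section \<open>Measurability of arrays\<close>

lemma measurable_array_spaceI:
  fixes f :: "'w \<Rightarrow> ('n::finite, 'a) array"
  assumes "\<And>i j. (\<lambda>\<omega>. f \<omega> i j) \<in> N \<rightarrow>\<^sub>M A"
  shows "f \<in> N \<rightarrow>\<^sub>M array_space A"
  unfolding array_space_def
  by (intro measurable_PiM_single' assms) (auto simp: space_PiM measurable_space[OF assms])

lemma measurable_array_entry:
  fixes f :: "'w \<Rightarrow> ('n::finite, 'a) array"
  assumes "f \<in> N \<rightarrow>\<^sub>M array_space A"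
  shows "(\<lambda>\<omega>. f \<omega> i j) \<in> N \<rightarrow>\<^sub>M A"
proof -
  have "(\<lambda>\<omega>. f \<omega> i) \<in> N \<rightarrow>\<^sub>M (\<Pi>\<^sub>M j\<in>UNIV. A)"
    using measurable_compose[OF assms[unfolded array_space_def] measurable_component_singleton] by auto
  from measurable_compose[OF this measurable_component_singleton] show ?thesis by auto
qed

lemma measurable_permute_array:
  fixes f :: "'w \<Rightarrow> ('n::finite, 'a) array"
  assumes "f \<in> N \<rightarrow>\<^sub>M array_space A"
  shows "(\<lambda>\<omega>. permute_array \<sigma> (f \<omega>)) \<in> N \<rightarrow>\<^sub>M array_space A"
  unfolding permute_array_def
  by (intro measurable_array_spaceI measurable_array_entry[OF assms])

lemma measurable_obs_array:
  fixes Y :: "'w \<Rightarrow> ('n::finite, real) array"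
  assumes Y: "Y \<in> N \<rightarrow>\<^sub>M array_space borel" and X: "\<And>i. (\<lambda>\<omega>. X \<omega> i) \<in> N \<rightarrow>\<^sub>M MX"
    and E: "E \<in> N \<rightarrow>\<^sub>M array_space ME"
  shows "(\<lambda>\<omega>. obs_array (Y \<omega>) (X \<omega>) (E \<omega>)) \<in> N \<rightarrow>\<^sub>M array_space (obs_space MX ME)"
  unfolding obs_array_def obs_space_def
  by (intro measurable_array_spaceI measurable_Pair X measurable_array_entry[OF Y]
      measurable_array_entry[OF E])

lemma measurable_covs_array:
  fixes E :: "'w \<Rightarrow> ('n::finite, 'e) array"
  assumes X: "\<And>i. (\<lambda>\<omega>. X \<omega> i) \<in> N \<rightarrow>\<^sub>M MX" and E: "E \<in> N \<rightarrow>\<^sub>M array_space ME"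
    and M: "M \<in> N \<rightarrow>\<^sub>M array_space bool_space"
  shows "(\<lambda>\<omega>. covs_array (X \<omega>) (E \<omega>) (M \<omega>)) \<in> N \<rightarrow>\<^sub>M array_space (covs_space MX ME)"
  unfolding covs_array_def covs_space_def
  by (intro measurable_array_spaceI measurable_Pair X measurable_array_entry[OF E]
      measurable_array_entry[OF M])

lemma measurable_scores:
  fixes Y :: "'w \<Rightarrow> ('n::finite, real) array"
  assumes Y: "Y \<in> N \<rightarrow>\<^sub>M array_space borel" and X: "\<And>i. (\<lambda>\<omega>. X \<omega> i) \<in> N \<rightarrow>\<^sub>M MX"
    and E: "E \<in> N \<rightarrow>\<^sub>M array_space ME" and M: "M \<in> N \<rightarrow>\<^sub>M array_space bool_space"
    and M1: "M1 \<in> N \<rightarrow>\<^sub>M array_space bool_space" and M2: "M2 \<in> N \<rightarrow>\<^sub>M array_space bool_space"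
    and \<zeta>: "\<zeta> \<in> array_space (covs_space MX ME) \<rightarrow>\<^sub>M array_space (summ_space MZ MP)"
    and mu: "measurable_model MX ME MZ MP mu"
    and s: "case_prod s \<in> borel_measurable (borel \<Otimes>\<^sub>M borel)"
  shows "(\<lambda>\<omega>. scores s mu \<zeta> (Y \<omega>) (X \<omega>) (E \<omega>) (M \<omega>) (M1 \<omega>) (M2 \<omega>)) \<in> N \<rightarrow>\<^sub>M array_space borel"
proof (rule measurable_array_spaceI)
  fix i j
  note V = measurable_obs_array[OF Y X E] and XX = measurable_covs_array[OF X E M]
  note Z = measurable_compose[OF XX \<zeta>]
  \<comment> \<open>The argument at which \<open>measurable_model\<close> provides measurability:
    one information entry, together with the whole arrays from which \<open>train_split\<close> cuts
    the training sample.\<close>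
  have "(\<lambda>\<omega>. ((covs_array (X \<omega>) (E \<omega>) (M \<omega>) i j, \<zeta> (covs_array (X \<omega>) (E \<omega>) (M \<omega>)) i j, M2 \<omega> i j),
      obs_array (Y \<omega>) (X \<omega>) (E \<omega>), \<zeta> (covs_array (X \<omega>) (E \<omega>) (M \<omega>)), M1 \<omega>)) \<in> N \<rightarrow>\<^sub>M
      ((covs_space MX ME \<Otimes>\<^sub>M summ_space MZ MP \<Otimes>\<^sub>M bool_space) \<Otimes>\<^sub>M
        array_space (obs_space MX ME) \<Otimes>\<^sub>M array_space (summ_space MZ MP) \<Otimes>\<^sub>M
        array_space bool_space)"
    by (intro measurable_Pair V Z M1 measurable_array_entry[OF XX] measurable_array_entry[OF Z]
        measurable_array_entry[OF M2])
  from measurable_compose[OF this mu[unfolded measurable_model_def]]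
  have "(\<lambda>\<omega>. fitted_split mu (obs_array (Y \<omega>) (X \<omega>) (E \<omega>)) (covs_array (X \<omega>) (E \<omega>) (M \<omega>))
      (\<zeta> (covs_array (X \<omega>) (E \<omega>) (M \<omega>))) (M1 \<omega>) (M2 \<omega>) i j) \<in> borel_measurable N"
    by (simp add: fitted_split_def info_split_def)
  from measurable_compose[OF measurable_Pair[OF measurable_array_entry[OF Y, of i j] this] s]
  show "(\<lambda>\<omega>. scores s mu \<zeta> (Y \<omega>) (X \<omega>) (E \<omega>) (M \<omega>) (M1 \<omega>) (M2 \<omega>) i j) \<in> borel_measurable N"
    by (simp add: scores_def Let_def)
qed

section \<open>The conformal p-value\<close>

lemma Pi_split_eq_card:
  "Pi_split S M2 k l =
     real (card {p \<in> calib_pairs M2. S k l \<le> case_prod S p}) / real (card (calib_pairs M2))"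
proof -
  have "(\<Sum>(i, j)\<in>calib_pairs M2. of_bool (S i j \<ge> S k l) :: real) =
      (\<Sum>p\<in>calib_pairs M2. if S k l \<le> case_prod S p then 1 else 0)"
    by (intro sum.cong) auto
  also have "\<dots> = real (card {p \<in> calib_pairs M2. S k l \<le> case_prod S p})"
    by (simp add: sum.If_cases Int_def)
  finally show ?thesis by (simp add: Pi_split_def)
qed

text \<open>The set \<open>calib_pairs M2\<close> is random. Moving membership into the summand
  leaves sums over the fixed set of pairs \<open>i < j\<close>, so measurability reduces to that of
  the entries.\<close>

lemma Pi_split_eq_sum:
  "Pi_split S M2 k l =
     (\<Sum>(i, j)\<in>{(i, j). i < j}. of_bool (M2 i j \<and> S k l \<le> S i j)) /
     (\<Sum>(i, j)\<in>{(i, j). i < j}. of_bool (M2 i j))"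
proof -
  have count: "real (card {p. case p of (i, j) \<Rightarrow> i < j \<and> Q i j}) =
      (\<Sum>(i, j)\<in>{(i, j). i < j}. of_bool (Q i j))" for Q :: "'a \<Rightarrow> 'a \<Rightarrow> bool"
  proof -
    have "(\<Sum>(i, j)\<in>{(i, j). i < j}. of_bool (Q i j) :: real) =
        (\<Sum>p\<in>{(i, j). i < j}. if case_prod Q p then 1 else 0)"
      by (intro sum.cong) auto
    also have "\<dots> = real (card ({(i, j). i < j} \<inter> {p. case_prod Q p}))"
      by (simp add: sum.If_cases)
    also have "{(i, j). i < j} \<inter> {p. case_prod Q p} = {p. case p of (i, j) \<Rightarrow> i < j \<and> Q i j}"
      by auto
    finally show ?thesis by simp
  qed
  have "{p \<in> calib_pairs M2. S k l \<le> case_prod S p} =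
      {p. case p of (i, j) \<Rightarrow> i < j \<and> M2 i j \<and> S k l \<le> S i j}"
    by (auto simp: calib_pairs_def)
  then show ?thesis
    by (simp add: Pi_split_eq_card count calib_pairs_def)
qed

lemma measurable_Pi_split:
  fixes S :: "'w \<Rightarrow> ('n::{finite,linorder}, real) array"
  assumes S: "S \<in> N \<rightarrow>\<^sub>M array_space borel" and M2: "M2 \<in> N \<rightarrow>\<^sub>M array_space bool_space"
  shows "(\<lambda>\<omega>. Pi_split (S \<omega>) (M2 \<omega>) k l) \<in> borel_measurable N"
proof -
  note [measurable] = measurable_array_entry[OF S] measurable_array_entry[OF M2]
  show ?thesis
    unfolding Pi_split_eq_sum split_def by measurable
qed

text \<open>Take an element \<open>x\<close> of the set with the smallest value of \<open>f\<close>.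
  The whole set lies in \<open>{y \<in> H. f x \<le> f y}\<close>, and that set has at most
  \<open>c\<close> elements because \<open>x\<close> itself qualifies. Ties do no harm.\<close>

lemma card_low_rank_le:
  fixes f :: "'a \<Rightarrow> 'b::linorder" and c :: real
  assumes "finite H" "0 \<le> c"
  shows "real (card {x \<in> H. real (card {y \<in> H. f x \<le> f y}) \<le> c}) \<le> c"
proof (cases "{x \<in> H. real (card {y \<in> H. f x \<le> f y}) \<le> c} = {}")
  case False
  define B where "B = {x \<in> H. real (card {y \<in> H. f x \<le> f y}) \<le> c}"
  have "finite B" "B \<noteq> {}" using assms False by (auto simp: B_def)
  then obtain x where x: "x \<in> B" "\<forall>y\<in>B. f x \<le> f y"
    by (metis arg_min_if_finite(1) arg_min_least)
  have "card B \<le> card {y \<in> H. f x \<le> f y}"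
    using assms x by (intro card_mono) (auto simp: B_def)
  then show ?thesis
    using x by (auto simp: B_def)
next
  case True
  show ?thesis unfolding True using assms by simp
qed

text \<open>Clearing the denominator turns \<open>Pi_split S M2 i j \<le> t\<close> into a rank
  bound with \<open>c = t * card (calib_pairs M2)\<close>, to which \<open>card_low_rank_le\<close>
  applies. Without calibration pairs both sides are zero.\<close>

lemma card_Pi_split_le:
  fixes S :: "('n::{finite,linorder}, real) array"
  assumes "0 \<le> t"
  shows "real (card {(i, j) \<in> calib_pairs M2. Pi_split S M2 i j \<le> t}) \<le>
    t * real (card (calib_pairs M2))"
proof (cases "calib_pairs M2 = {}")
  case False
  then have pos: "0 < real (card (calib_pairs M2))"
    by (simp add: card_gt_0_iff)
  have "{(i, j) \<in> calib_pairs M2. Pi_split S M2 i j \<le> t} = {p \<in> calib_pairs M2.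
      real (card {q \<in> calib_pairs M2. case_prod S p \<le> case_prod S q}) \<le> t * real (card (calib_pairs M2))}"
    using pos by (auto simp: Pi_split_eq_card pos_divide_le_eq)
  then show ?thesis
    using card_low_rank_le[of "calib_pairs M2" "t * real (card (calib_pairs M2))" "case_prod S"] assms
    by simp
qed simp

lemma card_symmetric_pairs:
  fixes Q :: "'n::{finite,linorder} \<Rightarrow> 'n \<Rightarrow> bool"
  assumes "\<And>i j. Q i j = Q j i"
  shows "card {(i, j). i \<noteq> j \<and> Q i j} = 2 * card {(i, j). i < j \<and> Q i j}"
proof -
  have "{(i, j). i \<noteq> j \<and> Q i j} = {(i, j). i < j \<and> Q i j} \<union> {(i, j). j < i \<and> Q i j}"
    by auto
  moreover have "{(i, j). j < i \<and> Q i j} = prod.swap ` {(i, j). i < j \<and> Q i j}"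
    using assms by (force simp: image_iff)
  then have "card {(i, j). j < i \<and> Q i j} = card {(i, j). i < j \<and> Q i j}"
    by (simp add: card_image)
  moreover have "{(i, j). i < j \<and> Q i j} \<inter> {(i, j). j < i \<and> Q i j} = {}"
    by auto
  ultimately show ?thesis
    by (simp add: card_Un_disjoint)
qed

text \<open>A permutation may break \<open>i < j\<close> but preserves \<open>i \<noteq> j\<close>.
  For a symmetric relation the count over \<open>i \<noteq> j\<close> is twice the count over
  \<open>i < j\<close>, so invariance of the former passes to the latter.\<close>

lemma card_permuted_pairs:
  fixes Q :: "'n::{finite,linorder} \<Rightarrow> 'n \<Rightarrow> bool"
  assumes \<sigma>: "\<sigma> permutes UNIV" and sym: "\<And>i j. Q i j = Q j i"
  shows "card {(i, j). i < j \<and> Q (\<sigma> i) (\<sigma> j)} = card {(i, j). i < j \<and> Q i j}"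
proof -
  have inj: "inj \<sigma>" using \<sigma> by (simp add: permutes_inj)
  have "map_prod \<sigma> \<sigma> -` {(i, j). i \<noteq> j \<and> Q i j} = {(i, j). i \<noteq> j \<and> Q (\<sigma> i) (\<sigma> j)}"
    using inj by (auto simp: inj_eq)
  moreover have "card (map_prod \<sigma> \<sigma> -` {(i, j). i \<noteq> j \<and> Q i j}) = card {(i, j). i \<noteq> j \<and> Q i j}"
    using prod.inj_map[OF inj inj] map_prod_surj[OF permutes_surj[OF \<sigma>] permutes_surj[OF \<sigma>]]
    by (intro card_vimage_inj) auto
  ultimately have "card {(i, j). i \<noteq> j \<and> Q (\<sigma> i) (\<sigma> j)} = card {(i, j). i \<noteq> j \<and> Q i j}"
    by simp
  then show ?thesis
    unfolding card_symmetric_pairs[of Q, OF sym] card_symmetric_pairs[of "\<lambda>i j. Q (\<sigma> i) (\<sigma> j)", OF sym]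
    by simp
qed

text \<open>Numerator and denominator both count symmetric relations over \<open>i < j\<close>; in
  the numerator the threshold \<open>S (\<sigma> k) (\<sigma> l)\<close> is a constant. Both counts
  are therefore unchanged by relabelling, even if \<sigma> reverses the order of \<open>k\<close>
  and \<open>l\<close>.\<close>

lemma Pi_split_permute:
  fixes S :: "('n::{finite,linorder}, real) array"
  assumes "\<sigma> permutes UNIV" "\<And>i j. S i j = S j i" "\<And>i j. M2 i j = M2 j i"
  shows "Pi_split (permute_array \<sigma> S) (permute_array \<sigma> M2) k l = Pi_split S M2 (\<sigma> k) (\<sigma> l)"
proof -
  have *: "{p \<in> calib_pairs A. c \<le> case_prod B p} = {(i, j). i < j \<and> A i j \<and> c \<le> B i j}"
    for A :: "('n, bool) array" and B and c :: real
    by (auto simp: calib_pairs_def)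
  show ?thesis
    unfolding Pi_split_eq_card *
    using card_permuted_pairs[OF assms(1), of M2]
      card_permuted_pairs[OF assms(1), of "\<lambda>i j. M2 i j \<and> S (\<sigma> k) (\<sigma> l) \<le> S i j"] assms(2,3)
    by (simp add: permute_array_def calib_pairs_def)
qed

section \<open>Validity for exchangeable scores\<close>

text \<open>Double transitivity, which later carries the pair \<open>(k, l)\<close> to any other
  pair of active nodes.\<close>

lemma permutes_two_points:
  assumes "k \<in> A" "l \<in> A" "i \<in> A" "j \<in> A" "k \<noteq> l" "i \<noteq> j"
  obtains \<sigma> where "\<sigma> permutes A" "\<sigma> k = i" "\<sigma> l = j"
proof
  \<comment> \<open>The first transposition sends \<open>k\<close> to \<open>i\<close>. The second
    sends the image of \<open>l\<close> to \<open>j\<close> and fixes \<open>i\<close>, since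
    \<open>i\<close> differs from \<open>j\<close> and from the image of \<open>l\<close>.\<close>
  let ?\<tau> = "Transposition.transpose k i"
  let ?\<sigma> = "Transposition.transpose (?\<tau> l) j \<circ> ?\<tau>"
  have "?\<tau> l \<in> A" "?\<tau> l \<noteq> i"
    using assms by (auto simp: Transposition.transpose_def)
  then show "?\<sigma> permutes A"
    using assms by (intro permutes_compose permutes_swap_id)
  show "?\<sigma> k = i" "?\<sigma> l = j"
    using assms \<open>?\<tau> l \<noteq> i\<close> by auto
qed

text \<open>An inactive node has an incident edge with probability zero, and a finite union of null
  events is null.\<close>

lemma (in prob_space) AE_edge_active:
  fixes M2 :: "'a \<Rightarrow> ('n::finite, bool) array"
  assumes M2: "M2 \<in> M \<rightarrow>\<^sub>M array_space bool_space"
  shows "AE \<omega> in M. \<forall>i j. i \<noteq> j \<longrightarrow> M2 \<omega> i j \<longrightarrow> i \<in> active_nodes M M2"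
proof -
  note [measurable] = measurable_array_entry[OF M2]
  have "AE \<omega> in M. i \<notin> active_nodes M M2 \<longrightarrow> \<not> (\<exists>j. j \<noteq> i \<and> M2 \<omega> i j)" for i
  proof (cases "i \<in> active_nodes M M2")
    case False
    then have "prob {\<omega> \<in> space M. \<exists>j. j \<noteq> i \<and> M2 \<omega> i j} = 0"
      using measure_nonneg[of M "{\<omega> \<in> space M. \<exists>j. j \<noteq> i \<and> M2 \<omega> i j}"]
      by (auto simp: active_nodes_def)
    then show ?thesis
      by (subst (asm) prob_eq_0) auto
  qed simp
  then have "AE \<omega> in M. \<forall>i. i \<notin> active_nodes M M2 \<longrightarrow> \<not> (\<exists>j. j \<noteq> i \<and> M2 \<omega> i j)"
    by (simp add: AE_all_countable)
  then show ?thesis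
    by eventually_elim metis
qed

text \<open>Stated for an arbitrary random array \<open>S\<close>, so that the model enters only
  through the joint law of \<open>S\<close> and \<open>M2\<close>. The bound is obtained as
  \<open>prob (low k l) \<le> t * prob (edge k l)\<close>, and \<open>pos\<close> then permits
  division.\<close>

lemma (in prob_space) conformal_validity:
  fixes S :: "'a \<Rightarrow> ('n::{finite,linorder}, real) array"
  assumes S: "S \<in> M \<rightarrow>\<^sub>M array_space borel" and M2: "M2 \<in> M \<rightarrow>\<^sub>M array_space bool_space"
    and symS: "AE \<omega> in M. \<forall>i j. S \<omega> i j = S \<omega> j i"
    and symM2: "AE \<omega> in M. \<forall>i j. M2 \<omega> i j = M2 \<omega> j i"
    and exch: "\<And>\<sigma>. \<sigma> \<in> active_perms M M2 \<Longrightarrow>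
      distr M (array_space borel \<Otimes>\<^sub>M array_space bool_space)
        (\<lambda>\<omega>. (permute_array \<sigma> (S \<omega>), permute_array \<sigma> (M2 \<omega>))) =
      distr M (array_space borel \<Otimes>\<^sub>M array_space bool_space) (\<lambda>\<omega>. (S \<omega>, M2 \<omega>))"
    and "k < l" and pos: "\<P>(\<omega> in M. M2 \<omega> k l) > 0" and "0 \<le> t"
  shows "\<P>(\<omega> in M. Pi_split (S \<omega>) (M2 \<omega>) k l \<le> t \<bar> M2 \<omega> k l) \<le> t"
proof -
  define low where "low i j = {\<omega> \<in> space M. Pi_split (S \<omega>) (M2 \<omega>) i j \<le> t \<and> M2 \<omega> i j}" for i j
  define edge where "edge i j = {\<omega> \<in> space M. M2 \<omega> i j}" for i j
  define A where "A = active_nodes M M2"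
  define J where "J = {(i, j). i < j \<and> i \<in> A \<and> j \<in> A}"
  note [measurable] = measurable_array_entry[OF M2] measurable_Pi_split[OF S M2]
  have [measurable]: "low i j \<in> events" "edge i j \<in> events" for i j
    unfolding low_def edge_def by measurable
  \<comment> \<open>\<open>AE_edge_active\<close> covers the row index of an edge; symmetry of
    \<open>M2\<close> extends it to the column index.\<close>
  have active: "AE \<omega> in M. \<forall>i j. i < j \<longrightarrow> M2 \<omega> i j \<longrightarrow> (i, j) \<in> J"
    using AE_edge_active[OF M2] symM2
    by eventually_elim (simp add: J_def A_def, metis order_less_imp_not_eq order_less_imp_not_eq2)
  \<comment> \<open>Positivity of the conditioning event makes \<open>k\<close> and \<open>l\<close>
    active. Hence \<open>J\<close> is nonempty and its size can be cancelled at the end.\<close>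
  have kl: "(k, l) \<in> J"
  proof (rule ccontr)
    assume "(k, l) \<notin> J"
    with active \<open>k < l\<close> have "AE \<omega> in M. \<not> M2 \<omega> k l"
      by (auto elim!: eventually_mono)
    then have "\<P>(\<omega> in M. M2 \<omega> k l) = 0" by (subst prob_eq_0) auto
    with pos show False by simp
  qed
  then have cardJ: "0 < real (card J)" by (auto simp: card_gt_0_iff)

  \<comment> \<open>Equality of the two laws, read as equality of the probabilities of a measurable
    property \<open>Q\<close> of scores and calibration matrix.\<close>
  have transfer: "prob {\<omega> \<in> space M. Q (permute_array \<sigma> (S \<omega>)) (permute_array \<sigma> (M2 \<omega>))} =
      prob {\<omega> \<in> space M. Q (S \<omega>) (M2 \<omega>)}"
    if \<sigma>: "\<sigma> \<in> active_perms M M2"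
      and Q: "{z \<in> space (array_space borel \<Otimes>\<^sub>M array_space bool_space). case_prod Q z} \<in>
        sets (array_space borel \<Otimes>\<^sub>M array_space bool_space)" for \<sigma> Q
  proof -
    let ?D = "array_space borel \<Otimes>\<^sub>M array_space bool_space ::
      (('n, real) array \<times> ('n, bool) array) measure"
    have law: "measure (distr M ?D f) {z \<in> space ?D. case_prod Q z} =
        prob {\<omega> \<in> space M. case_prod Q (f \<omega>)}" if f: "f \<in> M \<rightarrow>\<^sub>M ?D" for f
      using measure_distr[OF f Q] measurable_space[OF f]
      by (auto intro!: arg_cong[where f = prob])
    show ?thesis
      using law[OF measurable_Pair[OF S M2]] exch[OF \<sigma>]
        law[OF measurable_Pair[OF measurable_permute_array[OF S] measurable_permute_array[OF M2]], of \<sigma> \<sigma>]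
      by simp
  qed

  have eq: "prob (low i j) = prob (low k l) \<and> prob (edge i j) = prob (edge k l)" if "(i, j) \<in> J" for i j
  proof -
    have ij: "i \<in> A" "j \<in> A" "i \<noteq> j" using that by (auto simp: J_def)
    then obtain \<sigma> where \<sigma>: "\<sigma> permutes A" "\<sigma> k = i" "\<sigma> l = j"
      using permutes_two_points[of k A l i j] kl by (auto simp: J_def)
    then have \<sigma>': "\<sigma> permutes UNIV" "\<sigma> \<in> active_perms M M2"
      by (auto simp: active_perms_def A_def intro: permutes_subset permutes_not_in)
    let ?D = "array_space borel \<Otimes>\<^sub>M array_space bool_space ::
      (('n, real) array \<times> ('n, bool) array) measure"
    note [measurable] = measurable_Pi_split[OF measurable_fst measurable_snd]
      measurable_array_entry[OF measurable_snd]
    \<comment> \<open>Since \<sigma> maps \<open>(k, l)\<close> to \<open>(i, j)\<close>, the entry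
      \<open>(k, l)\<close> of the permuted \<open>M2\<close> is by definition the entry
      \<open>(i, j)\<close> of \<open>M2\<close>.\<close>
    have "prob (edge i j) = prob (edge k l)"
      using transfer[OF \<sigma>'(2), of "\<lambda>S M2. M2 k l"] \<sigma>
      by (simp add: edge_def permute_array_def split_def)
    \<comment> \<open>For the p-value this identification is \<open>Pi_split_permute\<close>. Its
      symmetry hypotheses hold only almost surely, so the events agree up to a null set.\<close>
    moreover have "prob (low i j) = prob {\<omega> \<in> space M.
        Pi_split (permute_array \<sigma> (S \<omega>)) (permute_array \<sigma> (M2 \<omega>)) k l \<le> t \<and> permute_array \<sigma> (M2 \<omega>) k l}"
    proof (rule measure_eq_AE)
      note [measurable] = measurable_Pi_split[OF measurable_permute_array[OF S] measurable_permute_array[OF M2]]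
        measurable_array_entry[OF measurable_permute_array[OF M2]]
      show "{\<omega> \<in> space M. Pi_split (permute_array \<sigma> (S \<omega>)) (permute_array \<sigma> (M2 \<omega>)) k l \<le> t \<and>
          permute_array \<sigma> (M2 \<omega>) k l} \<in> events"
        by measurable
      show "AE \<omega> in M. (\<omega> \<in> low i j) = (\<omega> \<in> {\<omega> \<in> space M.
          Pi_split (permute_array \<sigma> (S \<omega>)) (permute_array \<sigma> (M2 \<omega>)) k l \<le> t \<and> permute_array \<sigma> (M2 \<omega>) k l})"
        using symS symM2
      proof eventually_elim
        case (elim \<omega>)
        then show ?case
          using Pi_split_permute[OF \<sigma>'(1), of "S \<omega>" "M2 \<omega>" k l] \<sigma>
          by (simp add: low_def permute_array_def)
      qed
    qed measurable
    moreover have "\<dots> = prob (low k l)"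
      using transfer[OF \<sigma>'(2), of "\<lambda>S M2. Pi_split S M2 k l \<le> t \<and> M2 k l"]
      by (simp add: low_def split_def)
    ultimately show ?thesis by simp
  qed

  have count: "(\<Sum>(i, j)\<in>J. indicator (B i j) \<omega> :: real) = real (card {(i, j) \<in> J. \<omega> \<in> B i j})"
    for B :: "'n \<Rightarrow> 'n \<Rightarrow> 'a set" and \<omega>
  proof -
    have "(\<Sum>(i, j)\<in>J. indicator (B i j) \<omega> :: real) = (\<Sum>p\<in>J. if \<omega> \<in> case_prod B p then 1 else 0)"
      by (intro sum.cong) auto
    also have "\<dots> = real (card (J \<inter> {p. \<omega> \<in> case_prod B p}))"
      by (simp add: sum.If_cases)
    also have "J \<inter> {p. \<omega> \<in> case_prod B p} = {(i, j) \<in> J. \<omega> \<in> B i j}" by auto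
    finally show ?thesis .
  qed
  \<comment> \<open>Almost surely \<open>J\<close> contains every calibration pair, so sums over the
    fixed set \<open>J\<close> count the random sets bounded in
    \<open>card_Pi_split_le\<close>.\<close>
  have pointwise: "AE \<omega> in M. (\<Sum>(i, j)\<in>J. indicator (low i j) \<omega>) \<le>
      t * (\<Sum>(i, j)\<in>J. indicator (edge i j) \<omega>)"
    using active AE_space
  proof eventually_elim
    case (elim \<omega>)
    have "{(i, j) \<in> J. \<omega> \<in> low i j} =
        {(i, j) \<in> calib_pairs (M2 \<omega>). Pi_split (S \<omega>) (M2 \<omega>) i j \<le> t}"
      and "{(i, j) \<in> J. \<omega> \<in> edge i j} = calib_pairs (M2 \<omega>)"
      using elim by (auto simp: low_def edge_def calib_pairs_def) (auto simp: J_def)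
    then show ?case
      unfolding count using card_Pi_split_le[OF \<open>0 \<le> t\<close>] by simp
  qed

  have total: "(\<integral>\<omega>. (\<Sum>(i, j)\<in>J. indicator (B i j) \<omega>) \<partial>M) = (\<Sum>(i, j)\<in>J. prob (B i j))"
    and int: "integrable M (\<lambda>\<omega>. \<Sum>(i, j)\<in>J. indicator (B i j) \<omega> :: real)"
    if [measurable]: "\<And>i j. B i j \<in> events" for B
    unfolding split_def by (auto simp: Bochner_Integration.integral_sum emeasure_eq_measure)
  \<comment> \<open>By \<open>eq\<close> the summands at both ends of this chain are constant over
    \<open>J\<close>. Keeping the random number of calibration pairs on the right, instead of
    dividing by it, lets linearity of expectation finish.\<close>
  have "real (card J) * prob (low k l) = (\<Sum>(i, j)\<in>J. prob (low i j))"
    using eq by (simp add: split_def)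
  also have "\<dots> = (\<integral>\<omega>. (\<Sum>(i, j)\<in>J. indicator (low i j) \<omega>) \<partial>M)"
    by (simp add: total)
  also have "\<dots> \<le> (\<integral>\<omega>. t * (\<Sum>(i, j)\<in>J. indicator (edge i j) \<omega>) \<partial>M)"
    using pointwise by (intro integral_mono_AE integrable_mult_right int) auto
  also have "\<dots> = t * (\<Sum>(i, j)\<in>J. prob (edge i j))"
    by (simp add: total)
  also have "\<dots> = real (card J) * (t * prob (edge k l))"
    using eq by (simp add: split_def)
  finally have "prob (low k l) \<le> t * prob (edge k l)"
    using cardJ by simp
  then show ?thesis
    using pos by (simp add: cond_prob_def low_def edge_def pos_divide_le_eq)
qed

section \<open>Equivariance of the scores\<close>

lemma permute_obs_array:
  "permute_array \<sigma> (obs_array Y X E) = obs_array (permute_array \<sigma> Y) (X \<circ> \<sigma>) (permute_array \<sigma> E)"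
  by (simp add: permute_array_def obs_array_def)

lemma permute_covs_array:
  "permute_array \<sigma> (covs_array X E M) = covs_array (X \<circ> \<sigma>) (permute_array \<sigma> E) (permute_array \<sigma> M)"
  by (simp add: permute_array_def covs_array_def)

text \<open>The first hypothesis makes the summaries of the permuted covariates the permuted
  summaries, so the second identifies the refitted values with the permuted fit; \<open>s\<close>
  acts entrywise. Both are assumed at a single outcome, because they are available only almost
  surely.\<close>

lemma scores_permute:
  fixes Y :: "('n, real) array"
  assumes "permute_array \<sigma> (\<zeta> (covs_array X E M)) = \<zeta> (permute_array \<sigma> (covs_array X E M))"
    and "permute_array \<sigma> (fitted_split mu (obs_array Y X E) (covs_array X E M)
          (\<zeta> (covs_array X E M)) M1 M2) =
        fitted_split mu (permute_array \<sigma> (obs_array Y X E)) (permute_array \<sigma> (covs_array X E M))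
          (permute_array \<sigma> (\<zeta> (covs_array X E M))) (permute_array \<sigma> M1) (permute_array \<sigma> M2)"
  shows "scores s mu \<zeta> (permute_array \<sigma> Y) (X \<circ> \<sigma>) (permute_array \<sigma> E) (permute_array \<sigma> M)
      (permute_array \<sigma> M1) (permute_array \<sigma> M2) =
    permute_array \<sigma> (scores s mu \<zeta> Y X E M M1 M2)"
  unfolding scores_def Let_def permute_obs_array[symmetric] permute_covs_array[symmetric]
    assms(1)[symmetric] assms(2)[symmetric]
  by (simp add: permute_array_def)

text \<open>Exchangeability speaks of the array \<open>V\<close>, not of \<open>Y\<close>,
  \<open>X\<close> and \<open>E\<close> separately, so the scores are needed as a function of
  \<open>V\<close>. Node covariates are read off the diagonal; on arrays of the form
  \<open>obs_array Y X E\<close> this recovers \<open>X\<close> exactly.\<close>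

definition obs_scores ::
  "(real \<Rightarrow> real \<Rightarrow> real) \<Rightarrow> ('n, 'x, 'e, 'z, 'p) model \<Rightarrow>
   (('n, ('x, 'e) covs) array \<Rightarrow> ('n, ('z, 'p) summ) array) \<Rightarrow>
   ('n, ('x, 'e) obs) array \<Rightarrow> ('n, bool) array \<Rightarrow> ('n, bool) array \<Rightarrow> ('n, bool) array \<Rightarrow>
   ('n, real) array" where
  "obs_scores s mu \<zeta> V = scores s mu \<zeta> (\<lambda>i j. fst (V i j)) (\<lambda>i. fst (snd (V i i)))
     (\<lambda>i j. snd (snd (snd (V i j))))"

lemma obs_scores_obs_array: "obs_scores s mu \<zeta> (obs_array Y X E) = scores s mu \<zeta> Y X E"
  by (simp add: obs_scores_def obs_array_def)

lemma measurable_obs_scores: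
  fixes V :: "'w \<Rightarrow> ('n::finite, ('x, 'e) obs) array"
  assumes V: "V \<in> N \<rightarrow>\<^sub>M array_space (obs_space MX ME)"
    and "M \<in> N \<rightarrow>\<^sub>M array_space bool_space"
    and "M1 \<in> N \<rightarrow>\<^sub>M array_space bool_space" "M2 \<in> N \<rightarrow>\<^sub>M array_space bool_space"
    and "\<zeta> \<in> array_space (covs_space MX ME) \<rightarrow>\<^sub>M array_space (summ_space MZ MP)"
    and "measurable_model MX ME MZ MP mu"
    and "case_prod s \<in> borel_measurable (borel \<Otimes>\<^sub>M borel)"
  shows "(\<lambda>\<omega>. obs_scores s mu \<zeta> (V \<omega>) (M \<omega>) (M1 \<omega>) (M2 \<omega>)) \<in> N \<rightarrow>\<^sub>M array_space borel"
proof -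
  note [measurable] = measurable_array_entry[OF V, unfolded obs_space_def]
  have "(\<lambda>\<omega> i j. fst (V \<omega> i j)) \<in> N \<rightarrow>\<^sub>M array_space borel"
    and "(\<lambda>\<omega> i j. snd (snd (snd (V \<omega> i j)))) \<in> N \<rightarrow>\<^sub>M array_space ME"
    by (rule measurable_array_spaceI, measurable)+
  moreover have "(\<lambda>\<omega>. fst (snd (V \<omega> i i))) \<in> N \<rightarrow>\<^sub>M MX" for i
    by measurable
  ultimately have "(\<lambda>\<omega>. scores s mu \<zeta> (\<lambda>i j. fst (V \<omega> i j)) (\<lambda>i. fst (snd (V \<omega> i i)))
      (\<lambda>i j. snd (snd (snd (V \<omega> i j)))) (M \<omega>) (M1 \<omega>) (M2 \<omega>)) \<in> N \<rightarrow>\<^sub>M array_space borel"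
    using assms(2-) by (intro measurable_scores)
  then show ?thesis
    unfolding obs_scores_def .
qed

text \<open>One fixed measurable map \<open>F\<close> produces scores and \<open>M2\<close> from the
  data, and almost surely it produces the permuted pair from the permuted data. Equality of the data
  laws is therefore pushed forward through \<open>F\<close>.\<close>

lemma distr_scores_permute:
  fixes Y :: "'w \<Rightarrow> ('n::{finite,linorder}, real) array"
  assumes Y: "Y \<in> P \<rightarrow>\<^sub>M array_space borel" and X: "\<And>i. (\<lambda>\<omega>. X \<omega> i) \<in> P \<rightarrow>\<^sub>M MX"
    and E: "E \<in> P \<rightarrow>\<^sub>M array_space ME" and M: "M \<in> P \<rightarrow>\<^sub>M array_space bool_space"
    and M1: "M1 \<in> P \<rightarrow>\<^sub>M array_space bool_space" and M2: "M2 \<in> P \<rightarrow>\<^sub>M array_space bool_space"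
    and \<zeta>: "\<zeta> \<in> array_space (covs_space MX ME) \<rightarrow>\<^sub>M array_space (summ_space MZ MP)"
    and mu: "measurable_model MX ME MZ MP mu"
    and s: "case_prod s \<in> borel_measurable (borel \<Otimes>\<^sub>M borel)"
    and exch: "exchangeable_splitting P MX ME (\<lambda>\<omega>. obs_array (Y \<omega>) (X \<omega>) (E \<omega>)) M M1 M2"
    and equiv: "equivariant_summaries P \<zeta> (\<lambda>\<omega>. covs_array (X \<omega>) (E \<omega>) (M \<omega>))"
    and inv: "permutation_invariant_model P mu
          (\<lambda>\<omega>. obs_array (Y \<omega>) (X \<omega>) (E \<omega>)) (\<lambda>\<omega>. covs_array (X \<omega>) (E \<omega>) (M \<omega>))
          (\<lambda>\<omega>. \<zeta> (covs_array (X \<omega>) (E \<omega>) (M \<omega>))) M1 M2"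
    and \<sigma>: "\<sigma> \<in> active_perms P M2"
  defines "S \<equiv> \<lambda>\<omega>. scores s mu \<zeta> (Y \<omega>) (X \<omega>) (E \<omega>) (M \<omega>) (M1 \<omega>) (M2 \<omega>)"
  shows "distr P (array_space borel \<Otimes>\<^sub>M array_space bool_space)
        (\<lambda>\<omega>. (permute_array \<sigma> (S \<omega>), permute_array \<sigma> (M2 \<omega>))) =
      distr P (array_space borel \<Otimes>\<^sub>M array_space bool_space) (\<lambda>\<omega>. (S \<omega>, M2 \<omega>))"
proof -
  let ?B = "array_space bool_space :: ('n, bool) array measure"
  define D where "D = (array_space (obs_space MX ME) :: ('n, _) array measure) \<Otimes>\<^sub>M ?B \<Otimes>\<^sub>M ?B \<Otimes>\<^sub>M ?B"
  define F where "F = (\<lambda>(V, M, M1, M2). (obs_scores s mu \<zeta> V M M1 M2, M2))"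
  define d where "d = (\<lambda>\<omega>. (obs_array (Y \<omega>) (X \<omega>) (E \<omega>), M \<omega>, M1 \<omega>, M2 \<omega>))"
  define d\<sigma> where "d\<sigma> = (\<lambda>\<omega>. (permute_array \<sigma> (obs_array (Y \<omega>) (X \<omega>) (E \<omega>)),
    permute_array \<sigma> (M \<omega>), permute_array \<sigma> (M1 \<omega>), permute_array \<sigma> (M2 \<omega>)))"
  have perm: "\<sigma> permutes UNIV" using \<sigma> by (simp add: active_perms_def)
  note V = measurable_obs_array[OF Y X E]
  have S: "S \<in> P \<rightarrow>\<^sub>M array_space borel"
    unfolding S_def by (rule measurable_scores[OF Y X E M M1 M2 \<zeta> mu s])
  have d: "d \<in> P \<rightarrow>\<^sub>M D"
    unfolding d_def D_def by (intro measurable_Pair V M M1 M2)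
  have d\<sigma>: "d\<sigma> \<in> P \<rightarrow>\<^sub>M D"
    unfolding d\<sigma>_def D_def by (intro measurable_Pair measurable_permute_array V M M1 M2)
  have F: "F \<in> D \<rightarrow>\<^sub>M array_space borel \<Otimes>\<^sub>M array_space bool_space"
    unfolding F_def D_def split_def
    by (intro measurable_Pair measurable_obs_scores[OF _ _ _ _ \<zeta> mu s]) measurable
  \<comment> \<open>The permuted observation array is again an \<open>obs_array\<close>, with
    covariates \<open>X \<omega> \<circ> \<sigma>\<close>, so \<open>obs_scores\<close> evaluates on
    it to the left side of \<open>scores_permute\<close>.\<close>
  have "AE \<omega> in P. (permute_array \<sigma> (S \<omega>), permute_array \<sigma> (M2 \<omega>)) = F (d\<sigma> \<omega>)"
    using equiv[unfolded equivariant_summaries_def, rule_format, OF perm]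
      inv[unfolded permutation_invariant_model_def, rule_format, OF perm]
  proof eventually_elim
    case (elim \<omega>)
    from scores_permute[OF elim] show ?case
      by (simp add: F_def d\<sigma>_def S_def permute_obs_array obs_scores_obs_array)
  qed
  then have "distr P (array_space borel \<Otimes>\<^sub>M array_space bool_space)
        (\<lambda>\<omega>. (permute_array \<sigma> (S \<omega>), permute_array \<sigma> (M2 \<omega>))) =
      distr P (array_space borel \<Otimes>\<^sub>M array_space bool_space) (\<lambda>\<omega>. F (d\<sigma> \<omega>))"
    by (intro distr_cong_AE measurable_Pair measurable_permute_array S M2
        measurable_compose[OF d\<sigma> F]) auto
  also have "\<dots> = distr (distr P D d\<sigma>) (array_space borel \<Otimes>\<^sub>M array_space bool_space) F"
    by (simp add: distr_distr[OF F d\<sigma>] comp_def)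
  also have "distr P D d\<sigma> = distr P D d"
    using exch \<sigma> unfolding exchangeable_splitting_def D_def d_def d\<sigma>_def Let_def by blast
  also have "distr (distr P D d) (array_space borel \<Otimes>\<^sub>M array_space bool_space) F =
      distr P (array_space borel \<Otimes>\<^sub>M array_space bool_space) (\<lambda>\<omega>. (S \<omega>, M2 \<omega>))"
    by (subst distr_distr[OF F d]) (simp add: comp_def F_def d_def S_def obs_scores_obs_array)
  finally show ?thesis .
qed

theorem theorem4p2:
  fixes P :: "'w measure"
    and MX :: "'x measure" and ME :: "'e measure" and MZ :: "'z measure" and MP :: "'p measure"
    and Y :: "'w \<Rightarrow> ('n::{finite,linorder}, real) array"
    and X :: "'w \<Rightarrow> 'n \<Rightarrow> 'x"
    and E :: "'w \<Rightarrow> ('n, 'e) array"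
    and M M1 M2 :: "'w \<Rightarrow> ('n, bool) array"
    and \<zeta> :: "('n, ('x, 'e) covs) array \<Rightarrow> ('n, ('z, 'p) summ) array"
    and mu :: "('n, 'x, 'e, 'z, 'p) model"
    and s :: "real \<Rightarrow> real \<Rightarrow> real"
    and k l :: 'n
  assumes "prob_space P"
    and "Y \<in> P \<rightarrow>\<^sub>M array_space borel"
    and "X \<in> P \<rightarrow>\<^sub>M (\<Pi>\<^sub>M i\<in>UNIV. MX)"
    and "E \<in> P \<rightarrow>\<^sub>M array_space ME"
    and "M \<in> P \<rightarrow>\<^sub>M array_space bool_space"
    and "M1 \<in> P \<rightarrow>\<^sub>M array_space bool_space"
    and "M2 \<in> P \<rightarrow>\<^sub>M array_space bool_space"
    and "summary_statistic MX ME MZ MP \<zeta>"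
    and "measurable_model MX ME MZ MP mu"
    and "case_prod s \<in> borel_measurable (borel \<Otimes>\<^sub>M borel)"
    and M2_symmetric: "AE \<omega> in P. \<forall>i j. M2 \<omega> i j = M2 \<omega> j i"
    and S_symmetric: "AE \<omega> in P. \<forall>i j.
          scores s mu \<zeta> (Y \<omega>) (X \<omega>) (E \<omega>) (M \<omega>) (M1 \<omega>) (M2 \<omega>) i j =
          scores s mu \<zeta> (Y \<omega>) (X \<omega>) (E \<omega>) (M \<omega>) (M1 \<omega>) (M2 \<omega>) j i"
    and exchangeable: "exchangeable_splitting P MX ME
          (\<lambda>\<omega>. obs_array (Y \<omega>) (X \<omega>) (E \<omega>)) M M1 M2"
    and network_covariates: "equivariant_summaries P \<zeta> (\<lambda>\<omega>. covs_array (X \<omega>) (E \<omega>) (M \<omega>))"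
    and invariant_model: "permutation_invariant_model P mu
          (\<lambda>\<omega>. obs_array (Y \<omega>) (X \<omega>) (E \<omega>)) (\<lambda>\<omega>. covs_array (X \<omega>) (E \<omega>) (M \<omega>))
          (\<lambda>\<omega>. \<zeta> (covs_array (X \<omega>) (E \<omega>) (M \<omega>))) M1 M2"
    and "k < l"
    and conditioning: "\<P>(\<omega> in P. M2 \<omega> k l) > 0"
  shows "(\<forall>t\<in>{0..1}.
            \<P>(\<omega> in P. Pi_split
                (scores s mu \<zeta> (Y \<omega>) (X \<omega>) (E \<omega>) (M \<omega>) (M1 \<omega>) (M2 \<omega>)) (M2 \<omega>) k l \<le> t
              \<bar> M2 \<omega> k l) \<le> t) \<and>
         (\<forall>\<alpha>\<in>{0..1}.
            \<P>(\<omega> in P. Y \<omega> k l \<in> C_split s mu \<zeta> (Y \<omega>) (X \<omega>) (E \<omega>) (M \<omega>) (M1 \<omega>) (M2 \<omega>) \<alpha> k l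
              \<bar> M2 \<omega> k l) \<ge> 1 - \<alpha>)"
proof -
  interpret prob_space P by fact
  let ?S = "\<lambda>\<omega>. scores s mu \<zeta> (Y \<omega>) (X \<omega>) (E \<omega>) (M \<omega>) (M1 \<omega>) (M2 \<omega>)"
  have X: "(\<lambda>\<omega>. X \<omega> i) \<in> P \<rightarrow>\<^sub>M MX" for i
    using measurable_compose[OF assms(3) measurable_component_singleton] by auto
  have \<zeta>: "\<zeta> \<in> array_space (covs_space MX ME) \<rightarrow>\<^sub>M array_space (summ_space MZ MP)"
    using assms(8) by (simp add: summary_statistic_def)
  note S = measurable_scores[OF assms(2) X assms(4-7) \<zeta> assms(9,10)]
  note exch = distr_scores_permute[OF assms(2) X assms(4-7) \<zeta> assms(9,10) exchangeable
      network_covariates invariant_model]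
  have valid: "\<P>(\<omega> in P. Pi_split (?S \<omega>) (M2 \<omega>) k l \<le> t \<bar> M2 \<omega> k l) \<le> t" if "0 \<le> t" for t
    using S assms(7) S_symmetric M2_symmetric exch \<open>k < l\<close> conditioning that
    by (rule conformal_validity)
  moreover have "\<P>(\<omega> in P. Y \<omega> k l \<in> C_split s mu \<zeta> (Y \<omega>) (X \<omega>) (E \<omega>) (M \<omega>) (M1 \<omega>) (M2 \<omega>) \<alpha> k l
      \<bar> M2 \<omega> k l) \<ge> 1 - \<alpha>" if "0 \<le> \<alpha>" for \<alpha>
  proof -
    note [measurable] = measurable_Pi_split[OF S assms(7)] measurable_array_entry[OF assms(7)]
    \<comment> \<open>Splitting the conditioning event by the p-value turns the bound on
      \<open>Pi_split\<close> into a lower bound for the complementary event.\<close>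
    have "\<P>(\<omega> in P. M2 \<omega> k l) = \<P>(\<omega> in P. \<not> Pi_split (?S \<omega>) (M2 \<omega>) k l \<le> \<alpha> \<and> M2 \<omega> k l) +
        \<P>(\<omega> in P. Pi_split (?S \<omega>) (M2 \<omega>) k l \<le> \<alpha> \<and> M2 \<omega> k l)"
      by (subst finite_measure_Union[symmetric]) (auto intro!: arg_cong[where f = prob])
    then have "\<P>(\<omega> in P. \<not> Pi_split (?S \<omega>) (M2 \<omega>) k l \<le> \<alpha> \<bar> M2 \<omega> k l) =
        1 - \<P>(\<omega> in P. Pi_split (?S \<omega>) (M2 \<omega>) k l \<le> \<alpha> \<bar> M2 \<omega> k l)"
      using conditioning by (simp add: cond_prob_def field_simps)
    \<comment> \<open>Substituting the observed \<open>Y \<omega> k l\<close> as candidate leaves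
      \<open>Y \<omega>\<close> unchanged, so coverage is exactly the event that the p-value exceeds
      \<alpha>.\<close>
    then show ?thesis
      using valid[OF that] by (simp add: C_split_def not_le)
  qed
  ultimately show ?thesis by simp
qed

end
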